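(* Let $f:\mathbb{B}^n\to\mathbb{B}^n$ be a M\"obius transformation mapping $\mathbb{B}^n$ onto itself, and let $a\in\mathbb{B}^n$ with $f(a)=0$. Then, for all $x,y\in\mathbb{B}^n$, $$\frac{1-|a|}{1+|a|}\,\tilde c_{\mathbb{B}^n}(x,y)\le\tilde c_{\mathbb{B}^n}(f(x),f(y))\le\frac{1+|a|}{1-|a|}\,\tilde c_{\mathbb{B}^n}(x,y).$$
   Context: $\mathbb{B}^n=\{z\in\mathbb{R}^n:|z|<1\}$ is the open unit ball with boundary $\partial\mathbb{B}^n=\{z\in\mathbb{R}^n:|z|=1\}$. For $x,y\in\mathbb{B}^n$, $\tilde c_{\mathbb{B}^n}(x,y)=\sup_{p\in\partial\mathbb{B}^n}\frac{|x-y|}{\max\{|x-p|,|y-p|\}}$. A M\"obius transformation is (the restriction of) a finite composition of reflections in spheres and hyperplanes of $\mathbb{R}^n\cup\{\infty\}$. *)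

theory Defs
  imports "HOL-Analysis.Analysis"
begin

text \<open>
  The extended space \<open>\<real>\<^sup>n \<union> {\<infinity>}\<close> is modelled by the option type, with \<open>None\<close> for the point at
  infinity (the same encoding as in the library's \<open>Alexandroff_compactification\<close>).
\<close>

fun sphere_reflection :: "'a::euclidean_space \<Rightarrow> real \<Rightarrow> 'a option \<Rightarrow> 'a option" where
  "sphere_reflection c r None = Some c"
| "sphere_reflection c r (Some x) =
     (if x = c then None else Some (c + (r / norm (x - c))\<^sup>2 *\<^sub>R (x - c)))"

text \<open>The hyperplane is \<open>{x. x \<bullet> u = t}\<close>; the normal \<open>u\<close> need not have norm 1.\<close>

fun hyperplane_reflection :: "'a::euclidean_space \<Rightarrow> real \<Rightarrow> 'a option \<Rightarrow> 'a option" where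
  "hyperplane_reflection u t None = None"
| "hyperplane_reflection u t (Some x) = Some (x - (2 * (x \<bullet> u - t) / (u \<bullet> u)) *\<^sub>R u)"

inductive moebius :: "('a::euclidean_space option \<Rightarrow> 'a option) \<Rightarrow> bool" where
  sphere: "0 < r \<Longrightarrow> moebius (sphere_reflection c r)"
| hyperplane: "u \<noteq> 0 \<Longrightarrow> moebius (hyperplane_reflection u t)"
| comp: "moebius g \<Longrightarrow> moebius h \<Longrightarrow> moebius (g \<circ> h)"

text \<open>\<open>f\<close> agrees on \<open>S\<close> with a Moebius transformation that has only finite values there;
  nothing is said about \<open>f\<close> outside \<open>S\<close>.\<close>

definition moebius_on :: "'a::euclidean_space set \<Rightarrow> ('a \<Rightarrow> 'a) \<Rightarrow> bool" where
  "moebius_on S f \<longleftrightarrow> (\<exists>g. moebius g \<and> (\<forall>x\<in>S. g (Some x) = Some (f x)))"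

text \<open>For \<open>x\<close>, \<open>y\<close> in the open unit ball the denominators are positive and at least
  \<open>norm (x - y) / 2\<close>, and the unit sphere is nonempty, so this is a genuine supremum.\<close>

definition c_tilde_ball :: "'a::euclidean_space \<Rightarrow> 'a \<Rightarrow> real" where
  "c_tilde_ball x y =
     (SUP p\<in>sphere 0 1. norm (x - y) / max (norm (x - p)) (norm (y - p)))"

end

theory Submission
  imports Defs
begin

text \<open>
  A Moebius transformation \<open>g\<close> satisfies \<open>|g x - g y| = \<mu> x * \<mu> y * |x - y|\<close> for a positive function \<open>\<mu>\<close>.
  If \<open>g\<close> preserves the ball, it preserves the unit sphere, so replacing \<open>x\<close>, \<open>y\<close>, \<open>p\<close> by their
  images changes \<open>|x - y| / max |x - p| |y - p|\<close> at most by the quotients of \<open>\<mu> p\<close> by \<open>\<mu> x\<close> and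
  \<open>\<mu> y\<close>. Either \<open>\<mu>\<close> is constant, or \<open>\<mu> x\<close> is proportional to \<open>1 / |x - b|\<close> with the pole \<open>b\<close> of
  \<open>g\<close>. Since \<open>|g p - g a| = 1\<close> on the sphere, \<open>|p - b| / |p - a|\<close> is constant there, which forces
  \<open>b = a / |a|\<^sup>2\<close>. Hence \<open>|a| |x - b|\<close> lies between \<open>1 - |a|\<close> and \<open>1 + |a|\<close> on the closed ball.
\<close>

section \<open>Scaling factors of Moebius transformations\<close>

text \<open>Setting the distance to infinity to 1 makes the scaling identity below hold for all
  points, poles included, and hence be closed under composition without case distinctions.\<close>

fun ext_dist :: "'a::euclidean_space option \<Rightarrow> 'a option \<Rightarrow> real" where
  "ext_dist None None = 0"
| "ext_dist None (Some y) = 1"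
| "ext_dist (Some x) None = 1"
| "ext_dist (Some x) (Some y) = norm (x - y)"

text \<open>For a Moebius transformation, \<open>\<mu>\<close> is the square root of the local
  magnification at finite points with finite image. Bijectivity and positivity let the notion pass
  to \<open>inv g\<close>.\<close>

definition scales_by ::
  "('a::euclidean_space option \<Rightarrow> 'a option) \<Rightarrow> ('a option \<Rightarrow> real) \<Rightarrow> bool" where
  "scales_by g \<mu> \<longleftrightarrow> bij g \<and> (\<forall>X. 0 < \<mu> X) \<and>
     (\<forall>X Y. ext_dist (g X) (g Y) = \<mu> X * \<mu> Y * ext_dist X Y)"

lemma scales_by_comp:
  assumes "scales_by g \<mu>" "scales_by h \<nu>"
  shows "scales_by (g \<circ> h) (\<lambda>X. \<mu> (h X) * \<nu> X)"
  using assms by (auto simp: scales_by_def bij_comp)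

lemma scales_by_inv:
  assumes "scales_by g \<mu>"
  shows "scales_by (inv g) (\<lambda>X. 1 / \<mu> (inv g X))"
proof -
  have g: "bij g" and pos: "\<And>X. 0 < \<mu> X"
    and d: "\<And>X Y. ext_dist (g X) (g Y) = \<mu> X * \<mu> Y * ext_dist X Y"
    using assms by (auto simp: scales_by_def)
  have "ext_dist (inv g X) (inv g Y) = 1 / \<mu> (inv g X) * (1 / \<mu> (inv g Y)) * ext_dist X Y" for X Y
    using d[of "inv g X" "inv g Y"] pos[of "inv g X"] pos[of "inv g Y"] g
    by (simp add: bij_is_surj surj_f_inv_f field_simps)
  then show ?thesis
    using g pos by (simp add: scales_by_def bij_imp_bij_inv)
qed

text \<open>The left side squared is
  \<open>r^4 (1/|u|^2 - 2 (u . v)/(|u|^2 |v|^2) + 1/|v|^2)\<close>; factoring out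
  \<open>1/(|u|^2 |v|^2)\<close> leaves \<open>|u - v|^2\<close>.\<close>

lemma norm_diff_inversion:
  fixes u v :: "'a::real_inner"
  assumes "u \<noteq> 0" "v \<noteq> 0"
  shows "norm ((r / norm u)\<^sup>2 *\<^sub>R u - (r / norm v)\<^sup>2 *\<^sub>R v)
       = r\<^sup>2 / (norm u * norm v) * norm (u - v)"
proof (rule power2_eq_imp_eq)
  show "(norm ((r / norm u)\<^sup>2 *\<^sub>R u - (r / norm v)\<^sup>2 *\<^sub>R v))\<^sup>2
      = (r\<^sup>2 / (norm u * norm v) * norm (u - v))\<^sup>2"
    using assms
    by (simp add: power2_norm_eq_inner power_mult_distrib power_divide inner_diff
        inner_commute divide_simps flip: power_mult)
      (simp add: power2_norm_eq_inner[symmetric] algebra_simps power2_eq_square)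
qed auto

text \<open>The unit distance to infinity dictates the two exceptional values: pairing
  \<open>y\<close> with \<open>c\<close> requires \<open>1 = \<mu> (Some c) * r\<close>, and pairing
  \<open>y\<close> with infinity requires
  \<open>r^2 / |y - c| = \<mu> None * r / |y - c|\<close>.\<close>

lemma scales_by_sphere_reflection:
  fixes c :: "'a::euclidean_space"
  assumes "0 < r"
  shows "scales_by (sphere_reflection c r)
    (\<lambda>X. case X of None \<Rightarrow> r | Some x \<Rightarrow> if x = c then 1 / r else r / norm (x - c))"
proof -
  have "sphere_reflection c r (sphere_reflection c r X) = X" for X
    using assms by (cases X) (auto simp: power2_eq_square)
  then have "bij (sphere_reflection c r)"
    by (intro o_bij[of "sphere_reflection c r"]) auto
  moreover have "ext_dist (sphere_reflection c r (Some x)) (sphere_reflection c r (Some y))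
      = r / norm (x - c) * (r / norm (y - c)) * norm (x - y)" if "x \<noteq> c" "y \<noteq> c" for x y
    using norm_diff_inversion[of "x - c" "y - c" r] that by (simp add: power2_eq_square)
  moreover have "norm (c - x) = norm (x - c)" for x
    by (rule norm_minus_commute)
  ultimately show ?thesis
    using assms unfolding scales_by_def
    by (auto split: option.splits simp: power2_eq_square elim!: ext_dist.elims)
qed

lemma scales_by_hyperplane_reflection:
  fixes u :: "'a::euclidean_space"
  assumes "u \<noteq> 0"
  shows "scales_by (hyperplane_reflection u t) (\<lambda>_. 1)"
proof -
  have "hyperplane_reflection u t (hyperplane_reflection u t X) = X" for X
    using assms by (cases X) (auto simp: inner_diff_left field_simps simp flip: scaleR_add_left)
  then have "bij (hyperplane_reflection u t)"
    by (intro o_bij[of "hyperplane_reflection u t"]) auto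
  moreover
  have "norm (x - (2 * (x \<bullet> u - t) / (u \<bullet> u)) *\<^sub>R u - (y - (2 * (y \<bullet> u - t) / (u \<bullet> u)) *\<^sub>R u))
      = norm (x - y)" for x y
  proof (rule power2_eq_imp_eq)
    define w where "w = x - y"
    have eq: "x - (2 * (x \<bullet> u - t) / (u \<bullet> u)) *\<^sub>R u - (y - (2 * (y \<bullet> u - t) / (u \<bullet> u)) *\<^sub>R u)
        = w - (2 * (w \<bullet> u) / (u \<bullet> u)) *\<^sub>R u"
      by (simp add: w_def algebra_simps diff_divide_distrib inner_diff_left)
    show "(norm (x - (2 * (x \<bullet> u - t) / (u \<bullet> u)) *\<^sub>R u - (y - (2 * (y \<bullet> u - t) / (u \<bullet> u)) *\<^sub>R u)))\<^sup>2
      = (norm (x - y))\<^sup>2"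
      unfolding eq w_def[symmetric] power2_norm_eq_inner using assms
      by (simp add: inner_diff inner_commute field_simps)
  qed auto
  then have "ext_dist (hyperplane_reflection u t X) (hyperplane_reflection u t Y) = ext_dist X Y" for X Y
    by (cases X; cases Y; simp)
  ultimately show ?thesis
    by (simp add: scales_by_def)
qed

lemma moebius_scales_by:
  "moebius g \<Longrightarrow> \<exists>\<mu>. scales_by g \<mu>"
  by (induction rule: moebius.induct)
    (blast intro: scales_by_sphere_reflection scales_by_hyperplane_reflection scales_by_comp)+

section \<open>Invariance of the unit sphere\<close>

text \<open>Approach \<open>p\<close> radially by \<open>t *\<^sub>R p\<close>. The images stay in
  the ball, which bounds \<open>\<mu>\<close> near the end of the radius and makes them converge to
  the image of \<open>p\<close>. That image is thus finite and in the closed ball; injectivity keeps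
  it out of the open ball, which is already filled by images of ball points.\<close>

lemma scales_by_sphere_into_sphere:
  fixes g :: "'a::euclidean_space option \<Rightarrow> 'a option"
  assumes sc: "scales_by g \<mu>" and ball: "g ` Some ` ball 0 1 = Some ` ball 0 1"
  shows "g ` Some ` sphere 0 1 \<subseteq> Some ` sphere 0 1"
proof clarsimp
  fix p :: 'a
  assume p: "norm p = 1"
  have g: "bij g" and pos: "\<And>X. 0 < \<mu> X"
    and d: "\<And>X Y. ext_dist (g X) (g Y) = \<mu> X * \<mu> Y * ext_dist X Y"
    using sc by (auto simp: scales_by_def)
  have in_ball: "\<exists>z. g (Some x) = Some z \<and> norm z < 1" if "norm x < 1" for x
  proof -
    have "x \<in> ball 0 1"
      using that by simp
    then have "g (Some x) \<in> Some ` ball 0 1"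
      using ball by blast
    then show ?thesis
      by auto
  qed
  \<comment> \<open>\<open>4 / \<mu> (Some 0)\<close> will bound
    \<open>\<mu> (Some (t *\<^sub>R p))\<close> for \<open>1/2 \<le> t < 1\<close>: the images of
    \<open>t *\<^sub>R p\<close> and \<open>0\<close> are less than 2 apart, the points themselves
    are at distance \<open>t\<close>.\<close>
  define M where "M = 4 * \<mu> (Some p) / \<mu> (Some 0)"
  have M: "0 < M"
    using pos by (simp add: M_def)
  have near: "ext_dist (g (Some p)) (g (Some (t *\<^sub>R p))) \<le> M * (1 - t)"
    if t: "1 / 2 \<le> t" "t < 1" for t
  proof -
    obtain z w where z: "g (Some (t *\<^sub>R p)) = Some z" "norm z < 1" and w: "g (Some 0) = Some w" "norm w < 1"
      using in_ball[of "t *\<^sub>R p"] in_ball[of 0] p t by auto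
    have "norm (z - w) < 2"
      using norm_triangle_ineq4[of z w] z w by linarith
    then have "\<mu> (Some (t *\<^sub>R p)) * \<mu> (Some 0) * t < 2"
      using d[of "Some (t *\<^sub>R p)" "Some 0"] z w p t by simp
    moreover have "\<mu> (Some (t *\<^sub>R p)) * \<mu> (Some 0) * (1 / 2) \<le> \<mu> (Some (t *\<^sub>R p)) * \<mu> (Some 0) * t"
      using pos t by (intro mult_left_mono) (auto simp: less_imp_le)
    ultimately have "\<mu> (Some (t *\<^sub>R p)) * \<mu> (Some 0) \<le> 4"
      by linarith
    then have le: "\<mu> (Some (t *\<^sub>R p)) \<le> 4 / \<mu> (Some 0)"
      using pos[of "Some 0"] by (simp add: pos_le_divide_eq)
    have "p - t *\<^sub>R p = (1 - t) *\<^sub>R p"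
      by (simp add: algebra_simps)
    then have "ext_dist (g (Some p)) (g (Some (t *\<^sub>R p)))
        = \<mu> (Some p) * (1 - t) * \<mu> (Some (t *\<^sub>R p))"
      using d[of "Some p" "Some (t *\<^sub>R p)"] p t by simp
    also have "\<dots> \<le> \<mu> (Some p) * (1 - t) * (4 / \<mu> (Some 0))"
      using le pos[of "Some p"] t by (intro mult_left_mono) auto
    also have "\<dots> = M * (1 - t)"
      by (simp add: M_def)
    finally show ?thesis .
  qed
  have "g (Some p) \<noteq> None"
  proof
    assume none: "g (Some p) = None"
    \<comment> \<open>Makes \<open>M * (1 - t)\<close> at most 1/2, whereas infinity is at distance
      1 from every finite point.\<close>
    define t where "t = max (1 / 2) (1 - 1 / (2 * M))"
    have t: "1 / 2 \<le> t" "t < 1"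
      using M by (auto simp: t_def)
    then obtain z where z: "g (Some (t *\<^sub>R p)) = Some z"
      using in_ball[of "t *\<^sub>R p"] p by auto
    have "M * (1 - t) \<le> M * (1 / (2 * M))"
      using M by (intro mult_left_mono) (auto simp: t_def)
    then show False
      using near[OF t] M by (simp add: z none)
  qed
  then obtain q where q: "g (Some p) = Some q"
    by auto
  have "norm q \<le> 1"
  proof (rule field_le_epsilon)
    fix e :: real
    assume e: "0 < e"
    define t where "t = max (1 / 2) (1 - e / M)"
    have t: "1 / 2 \<le> t" "t < 1"
      using M e by (auto simp: t_def)
    then obtain z where z: "g (Some (t *\<^sub>R p)) = Some z" "norm z < 1"
      using in_ball[of "t *\<^sub>R p"] p by auto
    have "M * (1 - t) \<le> M * (e / M)"
      using M by (intro mult_left_mono) (auto simp: t_def)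
    then have "norm (q - z) \<le> e"
      using near[OF t] M by (simp add: z q)
    then show "norm q \<le> 1 + e"
      using norm_triangle_sub[of q z] z by linarith
  qed
  moreover have "\<not> norm q < 1"
  proof
    assume "norm q < 1"
    then have "g (Some p) \<in> g ` Some ` ball 0 1"
      unfolding ball q by simp
    then show False
      using p g by (auto simp: bij_is_inj inj_eq)
  qed
  ultimately show "g (Some p) \<in> Some ` sphere 0 1"
    using q by simp
qed

text \<open>\<open>inv g\<close> also maps the ball onto itself, so the inclusion just proved,
  applied to \<open>inv g\<close>, gives the reverse one.\<close>

lemma scales_by_sphere:
  assumes "scales_by g \<mu>" and ball: "g ` Some ` ball 0 1 = Some ` ball 0 1"
  shows "g ` Some ` sphere 0 1 = Some ` sphere 0 1"
proof
  have g: "bij g"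
    using assms by (simp add: scales_by_def)
  have "inv g ` Some ` ball 0 1 = Some ` ball 0 1"
    by (subst ball[symmetric]) (simp add: g bij_is_inj image_image)
  from scales_by_sphere_into_sphere[OF scales_by_inv[OF assms(1)] this]
  have "g ` inv g ` Some ` sphere 0 1 \<subseteq> g ` Some ` sphere 0 1"
    by (rule image_mono)
  then show "Some ` sphere 0 1 \<subseteq> g ` Some ` sphere 0 1"
    using g by (simp add: bij_is_surj image_image surj_f_inv_f)
qed (rule scales_by_sphere_into_sphere[OF assms])

section \<open>The pole and the range of the scaling factor\<close>

text \<open>Squared, the hypothesis is affine in \<open>p\<close> on the sphere. Comparing
  \<open>p\<close> with \<open>- p\<close> isolates the linear part, giving
  \<open>b = C^2 a\<close>; the constant part then becomes
  \<open>(C^2 - 1) * (C^2 |a|^2 - 1) = 0\<close>, and \<open>C^2 = 1\<close> would mean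
  \<open>a = b\<close>. So \<open>b\<close> is the reflection of \<open>a\<close> in the unit
  sphere.\<close>

lemma pole_is_inverse_point:
  fixes a b :: "'a::euclidean_space"
  assumes a: "norm a < 1" and "a \<noteq> b"
    and C: "\<And>p. norm p = 1 \<Longrightarrow> norm (p - b) = C * norm (p - a)"
  shows "C * norm a = 1" "b = C\<^sup>2 *\<^sub>R a"
proof -
  have sq: "1 + b \<bullet> b - 2 * (p \<bullet> b) = C\<^sup>2 * (1 + a \<bullet> a - 2 * (p \<bullet> a))" if "norm p = 1" for p
  proof -
    have "p \<bullet> p = 1"
      using that by (simp add: norm_eq_1)
    then show ?thesis
      using arg_cong[OF C[OF that], of "\<lambda>s. s\<^sup>2"]
      by (simp add: power_mult_distrib power2_norm_eq_inner inner_diff inner_commute)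
  qed
  have orth: "p \<bullet> (b - C\<^sup>2 *\<^sub>R a) = 0" if "norm p = 1" for p
    using sq[of p] sq[of "- p"] that by (simp add: inner_diff algebra_simps)
  show b: "b = C\<^sup>2 *\<^sub>R a"
  proof (rule ccontr)
    assume "b \<noteq> C\<^sup>2 *\<^sub>R a"
    then show False
      using orth[of "sgn (b - C\<^sup>2 *\<^sub>R a)"] by (simp add: sgn_div_norm norm_sgn)
  qed
  obtain p :: 'a where p: "norm p = 1"
    using vector_choose_size[of 1] by auto
  have "1 + b \<bullet> b = C\<^sup>2 * (1 + a \<bullet> a)"
    using sq[OF p] sq[of "- p"] p by (simp add: algebra_simps)
  moreover have "b \<bullet> b = C\<^sup>2 * (C\<^sup>2 * (a \<bullet> a))" "(C * norm a)\<^sup>2 = C\<^sup>2 * (a \<bullet> a)"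
    by (simp_all add: b power_mult_distrib power2_norm_eq_inner)
  ultimately have "(C\<^sup>2 - 1) * ((C * norm a)\<^sup>2 - 1) = 0"
    by algebra
  moreover have "C\<^sup>2 \<noteq> 1"
    using b \<open>a \<noteq> b\<close> by auto
  ultimately have "(C * norm a)\<^sup>2 = 1"
    by auto
  moreover have "p \<noteq> a"
    using a p by auto
  then have "0 \<le> C"
    using C[OF p] norm_ge_zero[of "p - b"] by (simp add: zero_le_mult_iff)
  ultimately show "C * norm a = 1"
    using power2_eq_imp_eq[of "C * norm a" 1] by simp
qed

text \<open>Source of the constant in the theorem: \<open>\<mu>\<close> is constant or inversely
  proportional to the distance from the pole, whose extreme values on the closed ball have the
  quotient \<open>(1 + |a|) / (1 - |a|)\<close>.\<close>

lemma scale_ratio: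
  fixes g :: "'a::euclidean_space option \<Rightarrow> 'a option"
  assumes sc: "scales_by g \<mu>" and ball: "g ` Some ` ball 0 1 = Some ` ball 0 1"
    and a: "norm a < 1" "g (Some a) = Some 0" and z: "norm z < 1" and p: "norm p = 1"
  shows "(1 - norm a) * \<mu> (Some z) \<le> (1 + norm a) * \<mu> (Some p)"
    and "(1 - norm a) * \<mu> (Some p) \<le> (1 + norm a) * \<mu> (Some z)"
proof -
  have g: "bij g" and pos: "\<And>X. 0 < \<mu> X"
    and d: "\<And>X Y. ext_dist (g X) (g Y) = \<mu> X * \<mu> Y * ext_dist X Y"
    using sc by (auto simp: scales_by_def)
  have finite: "\<exists>y. g (Some x) = Some y" if "norm x \<le> 1" for x
  proof -
    have "x \<in> ball 0 1 \<or> x \<in> sphere 0 1"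
      using that by auto
    then have "g (Some x) \<in> Some ` ball 0 1 \<or> g (Some x) \<in> Some ` sphere 0 1"
      using ball scales_by_sphere[OF sc ball] by blast
    then show ?thesis
      by blast
  qed
  have "(1 - norm a) * \<mu> (Some z) \<le> (1 + norm a) * \<mu> (Some p) \<and>
        (1 - norm a) * \<mu> (Some p) \<le> (1 + norm a) * \<mu> (Some z)"
  proof (cases "inv g None")
    case None
    then have "g None = None"
      using g by (metis bij_inv_eq_iff)
    \<comment> \<open>Infinity is fixed, so pairing \<open>x\<close> with it compares distance 1
      with distance 1.\<close>
    then have "\<mu> (Some x) * \<mu> None = 1" if "norm x \<le> 1" for x
      using d[of "Some x" None] finite[OF that] by auto
    from this[of z] this[of p] have "\<mu> (Some z) = \<mu> (Some p)"
      using z p pos[of None] by (metis less_eq_real_def less_irrefl mult_right_cancel)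
    then show ?thesis
      using pos[of "Some p"] by simp
  next
    case (Some b)
    then have gb: "g (Some b) = None"
      using g by (metis bij_inv_eq_iff)
    define k where "k = \<mu> (Some b)"
    \<comment> \<open>Pairing with the pole: the image distance is the distance to infinity, hence
      1.\<close>
    have \<mu>: "\<mu> (Some x) * (k * norm (x - b)) = 1" if "norm x \<le> 1" for x
      using d[of "Some x" "Some b"] finite[OF that] gb by (auto simp: k_def mult.assoc)
    have k: "0 < k"
      using pos by (simp add: k_def)
    have "a \<noteq> b"
      using \<mu>[of a] a by auto
    have "norm (q - b) = \<mu> (Some a) / k * norm (q - a)" if q: "norm q = 1" for q
    proof -
      obtain q' where q': "g (Some q) = Some q'" "norm q' = 1"
      proof -
        have "q \<in> sphere 0 1"
          using q by simp
        then have "g (Some q) \<in> Some ` sphere 0 1"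
          using scales_by_sphere[OF sc ball] by blast
        then show thesis
          using that by auto
      qed
      \<comment> \<open>As \<open>a\<close> goes to the centre and \<open>q\<close> to the sphere,
        this image distance is 1 too; it can be equated with the one for the pole.\<close>
      have "\<mu> (Some q) * \<mu> (Some a) * norm (q - a) = 1"
        using d[of "Some q" "Some a"] q' a by simp
      then have "\<mu> (Some q) * (\<mu> (Some a) * norm (q - a)) = \<mu> (Some q) * (k * norm (q - b))"
        using \<mu>[of q] q by simp
      then have "\<mu> (Some a) * norm (q - a) = k * norm (q - b)"
        using pos[of "Some q"] by simp
      then show ?thesis
        using k by (simp add: field_simps)
    qed
    note C = this
    define C where "C = \<mu> (Some a) / k"
    have Ca: "C * norm a = 1" and b: "b = C\<^sup>2 *\<^sub>R a"
      using pole_is_inverse_point[OF a(1) \<open>a \<noteq> b\<close>, of C] C by (auto simp: C_def)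
    have C0: "0 < C"
      using pos k by (simp add: C_def)
    have nb: "norm b = C"
      using Ca C0 unfolding b by (simp add: power2_eq_square mult.assoc)
    \<comment> \<open>On the closed ball the distance to \<open>b\<close> lies between
      \<open>|b| - 1\<close> and \<open>|b| + 1\<close>, where \<open>|b| = C\<close> and
      \<open>1 = C * |a|\<close>.\<close>
    have "C * (1 - norm a) \<le> norm (z - b)" "norm (z - b) \<le> C * (1 + norm a)"
      using norm_triangle_ineq2[of b z] norm_triangle_ineq4[of z b] nb z Ca
      by (auto simp: norm_minus_commute algebra_simps)
    moreover have "C * (1 - norm a) \<le> norm (p - b)" "norm (p - b) \<le> C * (1 + norm a)"
      using norm_triangle_ineq2[of b p] norm_triangle_ineq4[of p b] nb p Ca
      by (auto simp: norm_minus_commute algebra_simps)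
    ultimately have "(1 - norm a) * norm (p - b) \<le> (1 - norm a) * (C * (1 + norm a))"
        "(1 + norm a) * (C * (1 - norm a)) \<le> (1 + norm a) * norm (z - b)"
        "(1 - norm a) * norm (z - b) \<le> (1 - norm a) * (C * (1 + norm a))"
        "(1 + norm a) * (C * (1 - norm a)) \<le> (1 + norm a) * norm (p - b)"
      using a by (auto intro!: mult_left_mono simp: add_nonneg_nonneg)
    then have le: "(1 - norm a) * norm (p - b) \<le> (1 + norm a) * norm (z - b)"
      "(1 - norm a) * norm (z - b) \<le> (1 + norm a) * norm (p - b)"
      by (simp_all add: mult.commute mult.left_commute)
    have z1: "\<mu> (Some z) * (k * norm (z - b)) = 1" and p1: "\<mu> (Some p) * (k * norm (p - b)) = 1"
      using \<mu> z p by auto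
    \<comment> \<open>Multiplying by \<open>s\<close> turns the distance of either point to
      \<open>b\<close> into \<open>\<mu>\<close> at the other point.\<close>
    define s where "s = k * \<mu> (Some z) * \<mu> (Some p)"
    have "0 \<le> s"
      using k pos by (simp add: s_def less_imp_le)
    have "s * norm (z - b) = \<mu> (Some p)" "s * norm (p - b) = \<mu> (Some z)"
      using z1 p1 unfolding s_def by algebra+
    then show ?thesis
      using mult_left_mono[OF le(1) \<open>0 \<le> s\<close>] mult_left_mono[OF le(2) \<open>0 \<le> s\<close>]
      by (simp add: mult.left_commute[of s])
  qed
  then show "(1 - norm a) * \<mu> (Some z) \<le> (1 + norm a) * \<mu> (Some p)"
    and "(1 - norm a) * \<mu> (Some p) \<le> (1 + norm a) * \<mu> (Some z)"
    by auto
qed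

section \<open>Comparison of the suprema\<close>

lemma bdd_above_c_tilde_ball:
  fixes x y :: "'a::euclidean_space"
  shows "bdd_above ((\<lambda>p. norm (x - y) / max (norm (x - p)) (norm (y - p))) ` S)"
proof (rule bdd_aboveI2)
  fix p
  have "norm (x - y) \<le> 2 * max (norm (x - p)) (norm (y - p))"
    using norm_triangle_ineq4[of "x - p" "y - p"] by (auto simp: max_def)
  moreover have "0 \<le> max (norm (x - p)) (norm (y - p))"
    by (simp add: le_max_iff_disj)
  \<comment> \<open>The denominator vanishes only for \<open>p = x = y\<close>, where the quotient
    is 0 by the convention for division by zero.\<close>
  ultimately show "norm (x - y) / max (norm (x - p)) (norm (y - p)) \<le> 2"
    by (cases "max (norm (x - p)) (norm (y - p)) = 0") (auto simp: divide_le_eq)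
qed

text \<open>The point \<open>q\<close> may depend on \<open>p\<close>: it will be the image or the
  preimage of \<open>p\<close> under \<open>g\<close>.\<close>

lemma c_tilde_ball_le:
  fixes x y x' y' :: "'a::euclidean_space"
  assumes "0 < K" and
    "\<And>p. p \<in> sphere 0 1 \<Longrightarrow> \<exists>q \<in> sphere 0 1. norm (x - y) / max (norm (x - p)) (norm (y - p))
       \<le> K * (norm (x' - y') / max (norm (x' - q)) (norm (y' - q)))"
  shows "c_tilde_ball x y \<le> K * c_tilde_ball x' y'"
  unfolding c_tilde_ball_def
proof (rule cSUP_least)
  show "sphere (0 :: 'a) 1 \<noteq> {}"
    by simp
next
  fix p :: 'a
  assume "p \<in> sphere 0 1"
  then obtain q where q: "q \<in> sphere 0 1" and le:
    "norm (x - y) / max (norm (x - p)) (norm (y - p))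
       \<le> K * (norm (x' - y') / max (norm (x' - q)) (norm (y' - q)))"
    using assms(2) by blast
  note le
  also have "\<dots> \<le> K * (SUP q\<in>sphere 0 1. norm (x' - y') / max (norm (x' - q)) (norm (y' - q)))"
    using assms(1) q by (intro mult_left_mono cSUP_upper bdd_above_c_tilde_ball) auto
  finally show "norm (x - y) / max (norm (x - p)) (norm (y - p)) \<le> \<dots>" .
qed

text \<open>In use, \<open>m\<close>, \<open>k\<close>, \<open>l\<close> are \<open>\<mu>\<close> at
  \<open>p\<close>, \<open>x\<close>, \<open>y\<close>, and \<open>A\<close>, \<open>B\<close>,
  \<open>D\<close> are \<open>|x - p|\<close>, \<open>|y - p|\<close>, \<open>|x - y|\<close>. After
  cross-multiplication the maxima are compared entry by entry: \<open>k * l * A\<close> with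
  \<open>k * m * A\<close>, and \<open>k * l * B\<close> with \<open>l * m * B\<close>.\<close>

lemma max_ratio_le:
  fixes m k l K A B D :: real
  assumes "0 < m" "0 < k" "0 < l" "0 < A" "0 < B" "0 \<le> D" "0 < K"
  shows "l \<le> K * m \<Longrightarrow> k \<le> K * m \<Longrightarrow>
      k * l * D / max (k * m * A) (l * m * B) \<le> K * (D / max A B)"
    and "m \<le> K * l \<Longrightarrow> m \<le> K * k \<Longrightarrow>
      D / max A B \<le> K * (k * l * D / max (k * m * A) (l * m * B))"
proof -
  have pos: "0 < max A B" "0 < max (k * m * A) (l * m * B)"
    using assms by (auto simp: less_max_iff_disj)
  have ub: "A \<le> max A B" "B \<le> max A B" "k * m * A \<le> max (k * m * A) (l * m * B)"
    "l * m * B \<le> max (k * m * A) (l * m * B)"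
    by auto
  show "k * l * D / max (k * m * A) (l * m * B) \<le> K * (D / max A B)"
    if le: "l \<le> K * m" "k \<le> K * m"
  proof -
    have "l * (k * A) \<le> K * m * (k * A)" "k * (l * B) \<le> K * m * (l * B)"
      using le assms by (intro mult_right_mono; simp)+
    moreover have "K * (k * m * A) \<le> K * max (k * m * A) (l * m * B)"
      "K * (l * m * B) \<le> K * max (k * m * A) (l * m * B)"
      using ub assms by (intro mult_left_mono; simp)+
    ultimately have "k * l * max A B \<le> K * max (k * m * A) (l * m * B)"
      unfolding max_def[of A B] by (auto simp: ac_simps)
    from mult_left_mono[OF this \<open>0 \<le> D\<close>] show ?thesis
      using pos by (simp add: divide_simps ac_simps)
  qed
  show "D / max A B \<le> K * (k * l * D / max (k * m * A) (l * m * B))"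
    if le: "m \<le> K * l" "m \<le> K * k"
  proof -
    have "m * (k * A) \<le> K * l * (k * A)" "m * (l * B) \<le> K * k * (l * B)"
      using le assms by (intro mult_right_mono; simp)+
    moreover have "K * k * l * A \<le> K * k * l * max A B" "K * k * l * B \<le> K * k * l * max A B"
      using ub assms by (intro mult_left_mono; simp)+
    ultimately have "max (k * m * A) (l * m * B) \<le> K * k * l * max A B"
      unfolding max_def[of "k * m * A"] by (auto simp: ac_simps)
    from mult_left_mono[OF this \<open>0 \<le> D\<close>] show ?thesis
      using pos by (simp add: divide_simps ac_simps)
  qed
qed

theorem theorem9:
  fixes f :: "real ^ 'n \<Rightarrow> real ^ 'n" and a :: "real ^ 'n"
  assumes "moebius_on (ball 0 1) f"
    and "f ` ball 0 1 = ball 0 1"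
    and "a \<in> ball 0 1"
    and "f a = 0"
  shows "\<forall>x\<in>ball 0 1. \<forall>y\<in>ball 0 1.
    (1 - norm a) / (1 + norm a) * c_tilde_ball x y \<le> c_tilde_ball (f x) (f y) \<and>
    c_tilde_ball (f x) (f y) \<le> (1 + norm a) / (1 - norm a) * c_tilde_ball x y"
proof (intro ballI)
  fix x y :: "real ^ 'n"
  assume "x \<in> ball 0 1" "y \<in> ball 0 1"
  then have x: "norm x < 1" and y: "norm y < 1"
    by auto
  have a: "norm a < 1"
    using assms(3) by simp
  \<comment> \<open>\<open>f\<close> is known only on the open ball, so points of the sphere are
    moved by \<open>g\<close> instead.\<close>
  obtain g where g: "moebius g" and gf: "\<And>x. x \<in> ball 0 1 \<Longrightarrow> g (Some x) = Some (f x)"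
    using assms(1) unfolding moebius_on_def by blast
  obtain \<mu> where sc: "scales_by g \<mu>"
    using moebius_scales_by[OF g] by blast
  then have pos: "\<And>X. 0 < \<mu> X"
    and d: "\<And>X Y. ext_dist (g X) (g Y) = \<mu> X * \<mu> Y * ext_dist X Y"
    by (auto simp: scales_by_def)
  have "g ` Some ` ball 0 1 = Some ` f ` ball 0 1"
    unfolding image_image using gf by (intro image_cong) auto
  then have ball: "g ` Some ` ball 0 1 = Some ` ball 0 1"
    by (simp add: assms(2))
  note sphere = scales_by_sphere[OF sc ball]
  have ga: "g (Some a) = Some 0"
    using gf[OF assms(3)] assms(4) by simp
  define K where "K = (1 + norm a) / (1 - norm a)"
  have K: "0 < K"
    using a by (simp add: K_def add_pos_nonneg)
  have ratio: "\<mu> (Some z) \<le> K * \<mu> (Some p)" "\<mu> (Some p) \<le> K * \<mu> (Some z)"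
    if "norm z < 1" "norm p = 1" for z p
    using scale_ratio[OF sc ball a ga that] a by (simp_all add: K_def field_simps)
  have terms: "norm (f x - f y) / max (norm (f x - q)) (norm (f y - q))
        \<le> K * (norm (x - y) / max (norm (x - p)) (norm (y - p)))"
      "norm (x - y) / max (norm (x - p)) (norm (y - p))
        \<le> K * (norm (f x - f y) / max (norm (f x - q)) (norm (f y - q)))"
    if p: "norm p = 1" and q: "g (Some p) = Some q" for p q
  proof -
    have fx: "g (Some x) = Some (f x)" and fy: "g (Some y) = Some (f y)"
      using gf x y by auto
    have eqs: "norm (f x - f y) = \<mu> (Some x) * \<mu> (Some y) * norm (x - y)"
      "norm (f x - q) = \<mu> (Some x) * \<mu> (Some p) * norm (x - p)"
      "norm (f y - q) = \<mu> (Some y) * \<mu> (Some p) * norm (y - p)"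
      using d[of "Some x" "Some y"] d[of "Some x" "Some p"] d[of "Some y" "Some p"]
      by (simp_all add: fx fy q)
    have "0 < norm (x - p)" "0 < norm (y - p)"
      using x y p by auto
    note max = max_ratio_le[OF pos[of "Some p"] pos[of "Some x"] pos[of "Some y"] this
        norm_ge_zero[of "x - y"] K]
    show "norm (f x - f y) / max (norm (f x - q)) (norm (f y - q))
        \<le> K * (norm (x - y) / max (norm (x - p)) (norm (y - p)))"
      unfolding eqs by (intro max(1) ratio x y p)
    show "norm (x - y) / max (norm (x - p)) (norm (y - p))
        \<le> K * (norm (f x - f y) / max (norm (f x - q)) (norm (f y - q)))"
      unfolding eqs by (intro max(2) ratio x y p)
  qed
  have "c_tilde_ball (f x) (f y) \<le> K * c_tilde_ball x y"
  proof (rule c_tilde_ball_le[OF K])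
    fix q :: "real ^ 'n"
    assume "q \<in> sphere 0 1"
    \<comment> \<open>Here the image of the sphere must be the whole sphere: every \<open>q\<close>
      needs a preimage.\<close>
    then have "Some q \<in> g ` Some ` sphere 0 1"
      unfolding sphere by blast
    then obtain p where "p \<in> sphere 0 1" "g (Some p) = Some q"
      by auto
    then show "\<exists>p\<in>sphere 0 1. norm (f x - f y) / max (norm (f x - q)) (norm (f y - q))
        \<le> K * (norm (x - y) / max (norm (x - p)) (norm (y - p)))"
      using terms(1)[of p q] by auto
  qed
  \<comment> \<open>The lower bound is this estimate divided by \<open>K\<close>, because its
    constant is \<open>1 / K\<close>.\<close>
  moreover have "c_tilde_ball x y \<le> K * c_tilde_ball (f x) (f y)"
  proof (rule c_tilde_ball_le[OF K])
    fix p :: "real ^ 'n"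
    assume p: "p \<in> sphere 0 1"
    then have "g (Some p) \<in> Some ` sphere 0 1"
      using sphere by blast
    then obtain q where "q \<in> sphere 0 1" "g (Some p) = Some q"
      by auto
    then show "\<exists>q\<in>sphere 0 1. norm (x - y) / max (norm (x - p)) (norm (y - p))
        \<le> K * (norm (f x - f y) / max (norm (f x - q)) (norm (f y - q)))"
      using terms(2)[of p q] p by auto
  qed
  moreover from this have "inverse K * c_tilde_ball x y \<le> c_tilde_ball (f x) (f y)"
    using K by (simp add: field_simps)
  moreover have "inverse K = (1 - norm a) / (1 + norm a)"
    by (simp add: K_def)
  ultimately show "(1 - norm a) / (1 + norm a) * c_tilde_ball x y \<le> c_tilde_ball (f x) (f y) \<and>
    c_tilde_ball (f x) (f y) \<le> (1 + norm a) / (1 - norm a) * c_tilde_ball x y"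
    by (simp add: K_def)
qed

end
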